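(* For all $b\in\mathbb{C}$ and $a\in\mathbb{C}^*$, the $\mathfrak{sl}_2(\mathbb{C})$-modules $F_{(a,1)}(M_b')$ and $F_\tau\circ F_{(a,1)}(M_b')$ are simple.
   Context: $e_{i,j}$ are matrix units, $h:=\frac12(e_{1,1}-e_{2,2})\in\mathfrak{sl}_2(\mathbb{C})$, and $\sigma$ is the algebra automorphism of $\mathbb{C}[h]$ with $\sigma(h)=h-1$. $M_b'$ is the vector space $\mathbb{C}[h]$ with the $\mathfrak{sl}_2$-action $h\cdot f=hf$, $e_{1,2}\cdot f=\sigma f$, $e_{2,1}\cdot f=-(h+b+1)(h-b)\sigma^{-1}f$. Every automorphism $\varphi$ of $\mathcal{U}(\mathfrak{sl}_2)$ gives a functor $F_\varphi$ sending a module to the same vector space with new action $x\bullet v:=\varphi(x)\cdot v$. $F_\tau$ corresponds to $\tau(e_{i,j})=-e_{j,i}$, and for $a=(a_1,a_2)\in(\mathbb{C}^* )^2$, $F_a$ corresponds to $\varphi_a(e_{i,j})=\frac{a_i}{a_j}e_{i,j}$. *)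

theory Defs
  imports "HOL-Analysis.Analysis" "HOL-Computational_Algebra.Polynomial"
    "HOL-Library.Poly_Mapping"
begin

typedef sl2 = "{A :: complex^2^2. trace A = 0}" morphisms mat_of sl2_of
  by (rule exI[of _ 0]) (simp add: trace_def)

setup_lifting type_definition_sl2

instantiation sl2 :: ab_group_add
begin

lift_definition zero_sl2 :: sl2 is 0
  by (simp add: trace_def)

lift_definition plus_sl2 :: "sl2 \<Rightarrow> sl2 \<Rightarrow> sl2" is "(+)"
  by (simp add: trace_add)

lift_definition minus_sl2 :: "sl2 \<Rightarrow> sl2 \<Rightarrow> sl2" is "(-)"
  by (simp add: trace_sub)

lift_definition uminus_sl2 :: "sl2 \<Rightarrow> sl2" is uminus
  by (simp add: trace_def sum_negf)

instance
  by (standard; transfer; simp)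

end

lift_definition sl2_scale :: "complex \<Rightarrow> sl2 \<Rightarrow> sl2" is "\<lambda>c A. \<chi> i j. c * A $ i $ j"
  by (simp add: trace_def sum_distrib_left[symmetric])

lift_definition sl2_bracket :: "sl2 \<Rightarrow> sl2 \<Rightarrow> sl2" is "\<lambda>A B. A ** B - B ** A"
  using trace_mul_sym by (metis trace_sub right_minus_eq)

definition mat_unit :: "2 \<Rightarrow> 2 \<Rightarrow> complex^2^2" where
  "mat_unit i j = (\<chi> k l. if k = i \<and> l = j then 1 else 0)"

definition sl2_h :: sl2 where
  "sl2_h = sl2_scale (1/2) (sl2_of (mat_unit 1 1 - mat_unit 2 2))"

locale sl2_module = vector_space scale
  for scale :: "complex \<Rightarrow> 'v::ab_group_add \<Rightarrow> 'v" +
  fixes act :: "sl2 \<Rightarrow> 'v \<Rightarrow> 'v"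
  assumes act_linear: "Vector_Spaces.linear scale scale (act x)"
    and act_add_left: "act (x + y) v = act x v + act y v"
    and act_scale_left: "act (sl2_scale c x) v = scale c (act x v)"
    and act_bracket: "act (sl2_bracket x y) v = act x (act y v) - act y (act x v)"
begin

definition submodule :: "'v set \<Rightarrow> bool" where
  "submodule W \<longleftrightarrow> subspace W \<and> (\<forall>x. \<forall>w\<in>W. act x w \<in> W)"

end

definition simple_sl2_module ::
    "(complex \<Rightarrow> 'v::ab_group_add \<Rightarrow> 'v) \<Rightarrow> (sl2 \<Rightarrow> 'v \<Rightarrow> 'v) \<Rightarrow> bool" where
  "simple_sl2_module smul act \<longleftrightarrow>
     sl2_module smul act \<and> (UNIV :: 'v set) \<noteq> {0} \<and>
     (\<forall>W. sl2_module.submodule smul act W \<longrightarrow> W = {0} \<or> W = UNIV)"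

text \<open>
  The enveloping algebra is the free unital associative algebra on the set \<open>sl\<^sub>2(C)\<close> (finitely
  supported functions on words, with convolution product) modulo the two-sided ideal that makes
  the generators depend linearly on the elements of \<open>sl\<^sub>2(C)\<close> and turns commutators into brackets.
\<close>

datatype sl2_word = Word (letters: "sl2 list")

instantiation sl2_word :: monoid_add
begin

definition zero_sl2_word :: sl2_word where "0 = Word []"

definition plus_sl2_word :: "sl2_word \<Rightarrow> sl2_word \<Rightarrow> sl2_word" where
  "v + w = Word (letters v @ letters w)"

instance
  by standard (auto simp: zero_sl2_word_def plus_sl2_word_def)

end

type_synonym sl2_free = "sl2_word \<Rightarrow>\<^sub>0 complex"

definition free_gen :: "sl2 \<Rightarrow> sl2_free" where
  "free_gen x = Poly_Mapping.single (Word [x]) 1"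

definition free_const :: "complex \<Rightarrow> sl2_free" where
  "free_const c = Poly_Mapping.single 0 c"

definition U_relators :: "sl2_free set" where
  "U_relators =
     {free_gen (x + y) - free_gen x - free_gen y | x y. True}
   \<union> {free_gen (sl2_scale c x) - free_const c * free_gen x | c x. True}
   \<union> {free_gen x * free_gen y - free_gen y * free_gen x - free_gen (sl2_bracket x y) | x y. True}"

inductive_set U_ideal :: "sl2_free set" where
  zero: "0 \<in> U_ideal"
| add: "p \<in> U_ideal \<Longrightarrow> q \<in> U_ideal \<Longrightarrow> p + q \<in> U_ideal"
| relator: "r \<in> U_relators \<Longrightarrow> p * r * q \<in> U_ideal"

lemma U_ideal_mult_left: "p \<in> U_ideal \<Longrightarrow> a * p \<in> U_ideal"
proof (induction rule: U_ideal.induct)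
  case (relator r p q)
  then show ?case
    using U_ideal.relator[of r "a * p" q] by (simp add: mult.assoc)
qed (auto simp: distrib_left intro: U_ideal.intros)

lemma U_ideal_mult_right: "p \<in> U_ideal \<Longrightarrow> p * a \<in> U_ideal"
proof (induction rule: U_ideal.induct)
  case (relator r p q)
  then show ?case
    using U_ideal.relator[of r p "q * a"] by (simp add: mult.assoc)
qed (auto simp: distrib_right intro: U_ideal.intros)

lemma U_ideal_uminus: "p \<in> U_ideal \<Longrightarrow> - p \<in> U_ideal"
  using U_ideal_mult_left[of p "-1"] by simp

lemma U_ideal_diff: "p \<in> U_ideal \<Longrightarrow> q \<in> U_ideal \<Longrightarrow> p - q \<in> U_ideal"
  using U_ideal.add[of p "- q"] U_ideal_uminus by simp

definition free_act ::
    "(complex \<Rightarrow> 'v::ab_group_add \<Rightarrow> 'v) \<Rightarrow> (sl2 \<Rightarrow> 'v \<Rightarrow> 'v) \<Rightarrow> sl2_free \<Rightarrow> 'v \<Rightarrow> 'v" where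
  "free_act smul act p v =
     (\<Sum>w\<in>Poly_Mapping.keys p. smul (Poly_Mapping.lookup p w) (foldr act (letters w) v))"

lemma sl2_free_induct [case_names single add]:
  assumes single: "\<And>w c. P (Poly_Mapping.single w c)"
    and add: "\<And>p q. P p \<Longrightarrow> P q \<Longrightarrow> P (p + q)"
  shows "P (p :: sl2_free)"
proof (induction p rule: update_induct)
  case const
  then show ?case using single[of 0 0] by simp
next
  case (update p w c)
  have "Poly_Mapping.update w c p = p + Poly_Mapping.single w c"
    using update(1)
    by (intro poly_mapping_eqI)
      (auto simp: lookup_update lookup_add lookup_single when_def in_keys_iff)
  then show ?case using update(3) single add by simp
qed

context sl2_module
begin

lemma act_simps:
  "act x 0 = 0" "act x (u + v) = act x u + act x v" "act x (u - v) = act x u - act x v"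
  "act x (scale c v) = scale c (act x v)"
proof -
  interpret l: Vector_Spaces.linear scale scale "act x" by (rule act_linear)
  show "act x 0 = 0" "act x (u + v) = act x u + act x v" "act x (u - v) = act x u - act x v"
    "act x (scale c v) = scale c (act x v)"
    by (simp_all add: l.zero l.add l.diff l.scale)
qed

lemma word_act_add: "foldr act xs (u + v) = foldr act xs u + foldr act xs v"
  by (induction xs) (simp_all add: act_simps)

lemma word_act_scale: "foldr act xs (scale c v) = scale c (foldr act xs v)"
  by (induction xs) (simp_all add: act_simps)

lemma free_act_single:
  "free_act scale act (Poly_Mapping.single w c) v = scale c (foldr act (letters w) v)"
  by (simp add: free_act_def)

lemma free_act_add_left:
  "free_act scale act (p + q) v = free_act scale act p v + free_act scale act q v"
  unfolding free_act_def
  by (rule setsum_keys_plus_distrib) (simp_all add: scale_left_distrib)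

lemma free_act_zero_left: "free_act scale act 0 v = 0"
  by (simp add: free_act_def)

lemma free_act_diff_left:
  "free_act scale act (p - q) v = free_act scale act p v - free_act scale act q v"
  using free_act_add_left[of "p - q" q v] by simp

lemma free_act_add_right:
  "free_act scale act p (u + v) = free_act scale act p u + free_act scale act p v"
  by (simp add: free_act_def word_act_add scale_right_distrib sum.distrib)

lemma free_act_zero_right: "free_act scale act p 0 = 0"
  using free_act_add_right[of p 0 0] by simp

lemma free_act_mult:
  "free_act scale act (p * q) v = free_act scale act p (free_act scale act q v)"
proof (induction p rule: sl2_free_induct)
  case (single w c)
  show ?case
  proof (induction q rule: sl2_free_induct)
    case (single w' c')
    show ?case
      by (simp add: mult_single free_act_single plus_sl2_word_def word_act_scale)
  next
    case (add p q)
    then show ?case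
      by (simp add: distrib_left free_act_add_left free_act_add_right)
  qed
next
  case (add p q)
  then show ?case
    by (simp add: distrib_right free_act_add_left)
qed

lemma free_act_gen: "free_act scale act (free_gen x) v = act x v"
  by (simp add: free_gen_def free_act_single)

lemma free_act_const: "free_act scale act (free_const c) v = scale c v"
  by (simp add: free_const_def free_act_single zero_sl2_word_def)

lemma free_act_ideal: "p \<in> U_ideal \<Longrightarrow> free_act scale act p v = 0"
proof (induction arbitrary: v rule: U_ideal.induct)
  case (relator r p q)
  have "free_act scale act r u = 0" for u
    using relator
    by (auto simp: U_relators_def free_act_diff_left free_act_mult free_act_gen free_act_const
        act_add_left act_scale_left act_bracket)
  then show ?case
    by (simp add: free_act_mult free_act_zero_right)
qed (simp_all add: free_act_zero_left free_act_add_left)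

end

lemma one_notin_U_ideal: "1 \<notin> U_ideal"
proof
  assume "1 \<in> U_ideal"
  interpret vector_space "(*) :: complex \<Rightarrow> complex \<Rightarrow> complex"
    by unfold_locales (simp_all add: algebra_simps)
  interpret sl2_module "(*) :: complex \<Rightarrow> complex \<Rightarrow> complex" "\<lambda>x v. 0"
    by unfold_locales simp_all
  have "free_act (*) (\<lambda>x v. 0) 1 (1::complex) = 0"
    using \<open>1 \<in> U_ideal\<close> by (rule free_act_ideal)
  moreover have "free_act (*) (\<lambda>x v. 0) 1 (1::complex) = 1"
    using free_act_const[of 1 1] by (simp add: free_const_def)
  ultimately show False by simp
qed

definition U_cong :: "sl2_free \<Rightarrow> sl2_free \<Rightarrow> bool" where
  "U_cong p q \<longleftrightarrow> p - q \<in> U_ideal"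

lemma equivp_U_cong: "equivp U_cong"
proof (intro equivpI reflpI sympI transpI)
  fix p q r
  show "U_cong p p"
    unfolding U_cong_def using U_ideal.zero by simp
  show "U_cong q p" if "U_cong p q"
    using that U_ideal_uminus[of "p - q"] by (simp add: U_cong_def)
  show "U_cong p r" if "U_cong p q" "U_cong q r"
    using that U_ideal.add[of "p - q" "q - r"] by (simp add: U_cong_def)
qed

quotient_type usl2 = sl2_free / U_cong
  by (rule equivp_U_cong)

instantiation usl2 :: ring_1
begin

lift_definition zero_usl2 :: usl2 is 0 .

lift_definition one_usl2 :: usl2 is 1 .

lift_definition plus_usl2 :: "usl2 \<Rightarrow> usl2 \<Rightarrow> usl2" is "(+)"
  unfolding U_cong_def by (drule (1) U_ideal.add) (simp add: add_diff_add)

lift_definition minus_usl2 :: "usl2 \<Rightarrow> usl2 \<Rightarrow> usl2" is "(-)"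
  unfolding U_cong_def by (drule (1) U_ideal_diff) (simp add: diff_diff_eq2 algebra_simps)

lift_definition uminus_usl2 :: "usl2 \<Rightarrow> usl2" is uminus
  unfolding U_cong_def by (drule U_ideal_uminus) (simp add: algebra_simps)

lift_definition times_usl2 :: "usl2 \<Rightarrow> usl2 \<Rightarrow> usl2" is "(*)"
proof -
  fix p p' q q' assume "U_cong p p'" "U_cong q q'"
  then have "(p - p') * q + p' * (q - q') \<in> U_ideal"
    by (auto simp: U_cong_def intro: U_ideal.add U_ideal_mult_left U_ideal_mult_right)
  then show "U_cong (p * q) (p' * q')"
    by (simp add: U_cong_def algebra_simps)
qed

instance
proof
  show "(0::usl2) \<noteq> 1"
    using one_notin_U_ideal U_ideal_uminus[of "-1"] by transfer (auto simp: U_cong_def)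
qed (transfer, simp add: U_cong_def U_ideal.zero algebra_simps)+

end

definition U_scale :: "complex \<Rightarrow> usl2 \<Rightarrow> usl2" where
  "U_scale c u = abs_usl2 (free_const c) * u"

definition \<iota> :: "sl2 \<Rightarrow> usl2" where
  "\<iota> x = abs_usl2 (free_gen x)"

text \<open>
  For an actual \<open>sl\<^sub>2\<close>-module the choice of representative is irrelevant, and \<open>U_act\<close> is the unique
  action of the enveloping algebra extending the given one (\<open>U_act_abs\<close>, \<open>U_act_\<iota>\<close>, \<open>U_act_mult\<close>).
\<close>

definition U_act ::
    "(complex \<Rightarrow> 'v::ab_group_add \<Rightarrow> 'v) \<Rightarrow> (sl2 \<Rightarrow> 'v \<Rightarrow> 'v) \<Rightarrow> usl2 \<Rightarrow> 'v \<Rightarrow> 'v" where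
  "U_act smul act u v = free_act smul act (rep_usl2 u) v"

definition U_hom :: "(usl2 \<Rightarrow> usl2) \<Rightarrow> bool" where
  "U_hom \<phi> \<longleftrightarrow>
     \<phi> 1 = 1 \<and> (\<forall>u v. \<phi> (u + v) = \<phi> u + \<phi> v) \<and> (\<forall>u v. \<phi> (u * v) = \<phi> u * \<phi> v) \<and>
     (\<forall>c u. \<phi> (U_scale c u) = U_scale c (\<phi> u))"

definition U_automorphism :: "(usl2 \<Rightarrow> usl2) \<Rightarrow> bool" where
  "U_automorphism \<phi> \<longleftrightarrow> U_hom \<phi> \<and> bij \<phi>"

text \<open>
  The functor \<open>F\<^sub>\<phi>\<close> on objects: the result is again an \<open>sl\<^sub>2\<close>-module on the same vector space.
\<close>

definition F ::
    "(complex \<Rightarrow> 'v::ab_group_add \<Rightarrow> 'v) \<Rightarrow> (usl2 \<Rightarrow> usl2) \<Rightarrow> (sl2 \<Rightarrow> 'v \<Rightarrow> 'v) \<Rightarrow> sl2 \<Rightarrow> 'v \<Rightarrow> 'v" where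
  "F smul \<phi> act x v = U_act smul act (\<phi> (\<iota> x)) v"

lemma abs_usl2_eq_iff: "abs_usl2 p = abs_usl2 q \<longleftrightarrow> p - q \<in> U_ideal"
  by (simp add: usl2.abs_eq_iff U_cong_def)

lemma abs_usl2_simps:
  "abs_usl2 (p + q) = abs_usl2 p + abs_usl2 q" "abs_usl2 (p - q) = abs_usl2 p - abs_usl2 q"
  "abs_usl2 (p * q) = abs_usl2 p * abs_usl2 q" "abs_usl2 1 = 1"
  by (simp_all add: plus_usl2.abs_eq minus_usl2.abs_eq times_usl2.abs_eq one_usl2.abs_eq)

lemma relator_eq_0: "r \<in> U_relators \<Longrightarrow> abs_usl2 r = 0"
  using U_ideal.relator[of r 1 1] by (simp add: zero_usl2_def abs_usl2_eq_iff zero_usl2.abs_eq)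

lemma \<iota>_add: "\<iota> (x + y) = \<iota> x + \<iota> y"
proof -
  have "free_gen (x + y) - free_gen x - free_gen y \<in> U_relators"
    unfolding U_relators_def by blast
  from relator_eq_0[OF this] show ?thesis
    by (simp add: \<iota>_def abs_usl2_simps diff_eq_eq add.commute)
qed

lemma \<iota>_scale: "\<iota> (sl2_scale c x) = U_scale c (\<iota> x)"
proof -
  have "free_gen (sl2_scale c x) - free_const c * free_gen x \<in> U_relators"
    unfolding U_relators_def by blast
  from relator_eq_0[OF this] show ?thesis
    by (simp add: \<iota>_def U_scale_def abs_usl2_simps)
qed

lemma \<iota>_bracket: "\<iota> (sl2_bracket x y) = \<iota> x * \<iota> y - \<iota> y * \<iota> x"
proof -
  have "free_gen x * free_gen y - free_gen y * free_gen x - free_gen (sl2_bracket x y) \<in> U_relators"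
    unfolding U_relators_def by blast
  from relator_eq_0[OF this] show ?thesis
    by (simp add: \<iota>_def abs_usl2_simps)
qed

lemma free_const_add: "free_const (c + d) = free_const c + free_const d"
  and free_const_mult: "free_const (c * d) = free_const c * free_const d"
  and free_const_1: "free_const 1 = 1"
  by (simp_all add: free_const_def single_add mult_single)

lemma free_const_central: "free_const c * p = p * free_const c"
  by (induction p rule: sl2_free_induct)
    (simp_all add: free_const_def mult_single distrib_left distrib_right mult.commute)

lemma U_scale_mult: "U_scale c u * v = U_scale c (u * v)" "u * U_scale c v = U_scale c (u * v)"
proof -
  have "abs_usl2 (free_const c) * u = u * abs_usl2 (free_const c)"
    by (induction u rule: usl2.abs_induct) (metis abs_usl2_simps(3) free_const_central)
  then show "U_scale c u * v = U_scale c (u * v)" "u * U_scale c v = U_scale c (u * v)"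
    by (simp_all only: U_scale_def mult.assoc[symmetric])
qed

interpretation U: vector_space U_scale
  by unfold_locales
    (simp_all add: U_scale_def distrib_left distrib_right free_const_add free_const_mult
      free_const_1 abs_usl2_simps mult.assoc)

lemma usl2_induct [case_names \<iota> const add mult]:
  assumes \<iota>: "\<And>x. P (\<iota> x)" and const: "\<And>c. P (U_scale c 1)"
    and add: "\<And>u v. P u \<Longrightarrow> P v \<Longrightarrow> P (u + v)" and mult: "\<And>u v. P u \<Longrightarrow> P v \<Longrightarrow> P (u * v)"
  shows "P u"
proof (induction u rule: usl2.abs_induct)
  case (1 p)
  show ?case
  proof (induction p rule: sl2_free_induct)
    case (single w c)
    have "P (abs_usl2 (Poly_Mapping.single (Word xs) c))" for xs
    proof (induction xs)
      case Nil
      then show ?case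
        using const[of c] by (simp add: U_scale_def free_const_def zero_sl2_word_def)
    next
      case (Cons x xs)
      have "Poly_Mapping.single (Word (x # xs)) c = free_gen x * Poly_Mapping.single (Word xs) c"
        by (simp add: free_gen_def mult_single plus_sl2_word_def)
      then show ?case
        using mult[OF \<iota> Cons, of x] by (simp add: \<iota>_def abs_usl2_simps)
    qed
    then show ?case by (cases w) simp
  qed (simp add: add abs_usl2_simps)
qed

context sl2_module
begin

lemma U_act_abs: "U_act scale act (abs_usl2 p) v = free_act scale act p v"
proof -
  have "abs_usl2 (rep_usl2 (abs_usl2 p)) = abs_usl2 p"
    by (metis Quotient3_abs_rep Quotient3_usl2)
  then have "rep_usl2 (abs_usl2 p) - p \<in> U_ideal"
    by (simp add: abs_usl2_eq_iff)
  from free_act_ideal[OF this, of v] show ?thesis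
    by (simp add: U_act_def free_act_diff_left)
qed

lemma U_act_\<iota>: "U_act scale act (\<iota> x) v = act x v"
  by (simp add: \<iota>_def U_act_abs free_act_gen)

lemma U_act_one: "U_act scale act 1 v = v"
  using U_act_abs[of "free_const 1"] free_act_const[of 1 v] by (simp add: free_const_1 abs_usl2_simps)

lemma U_act_add: "U_act scale act (u + u') v = U_act scale act u v + U_act scale act u' v"
  by (induction u rule: usl2.abs_induct, induction u' rule: usl2.abs_induct)
    (simp add: U_act_abs free_act_add_left flip: abs_usl2_simps)

lemma U_act_mult: "U_act scale act (u * u') v = U_act scale act u (U_act scale act u' v)"
  by (induction u rule: usl2.abs_induct, induction u' rule: usl2.abs_induct)
    (simp add: U_act_abs free_act_mult flip: abs_usl2_simps)

lemma U_act_scale: "U_act scale act (U_scale c u) v = scale c (U_act scale act u v)"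
  by (simp add: U_scale_def U_act_mult U_act_abs free_act_const)

end

lemma U_hom_unique:
  assumes "U_hom \<phi>" "U_hom \<psi>" "\<And>x. \<phi> (\<iota> x) = \<psi> (\<iota> x)"
  shows "\<phi> = \<psi>"
proof
  fix u show "\<phi> u = \<psi> u"
    by (induction u rule: usl2_induct) (use assms in \<open>auto simp: U_hom_def\<close>)
qed

definition lie_hom :: "(sl2 \<Rightarrow> sl2) \<Rightarrow> bool" where
  "lie_hom g \<longleftrightarrow>
     (\<forall>x y. g (x + y) = g x + g y) \<and> (\<forall>c x. g (sl2_scale c x) = sl2_scale c (g x)) \<and>
     (\<forall>x y. g (sl2_bracket x y) = sl2_bracket (g x) (g y))"

lemma lie_hom_extends:
  assumes g: "lie_hom g"
  obtains \<phi> where "U_hom \<phi>" "\<And>x. \<phi> (\<iota> x) = \<iota> (g x)"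
proof -
  interpret M: sl2_module U_scale "\<lambda>x v. \<iota> (g x) * v"
    by unfold_locales
      (use g in \<open>simp_all add: lie_hom_def \<iota>_add \<iota>_scale \<iota>_bracket U_scale_mult
        distrib_left distrib_right left_diff_distrib mult.assoc\<close>)
  let ?A = "U_act U_scale (\<lambda>x v. \<iota> (g x) * v)"
  have *: "?A u v = ?A u 1 * v" for u v
  proof (induction u arbitrary: v rule: usl2_induct)
    case (mult u u')
    have "?A (u * u') v = ?A u (?A u' v)" by (rule M.U_act_mult)
    also have "\<dots> = ?A u 1 * (?A u' 1 * v)" using mult by metis
    also have "\<dots> = ?A u (?A u' 1) * v" using mult(1)[of "?A u' 1"] by (simp add: mult.assoc)
    finally show ?case by (simp add: M.U_act_mult)
  next
    case (add u u')
    then show ?case by (metis M.U_act_add distrib_right)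
  qed (simp_all add: M.U_act_\<iota> M.U_act_scale M.U_act_one U_scale_mult)
  have "?A (u * v) 1 = ?A u 1 * ?A v 1" for u v
    unfolding M.U_act_mult by (rule *)
  then have "U_hom (\<lambda>u. ?A u 1)"
    unfolding U_hom_def by (simp add: M.U_act_one M.U_act_add M.U_act_scale)
  then show thesis
    by (rule that) (simp add: M.U_act_\<iota>)
qed

lemma lie_hom_extends_bij:
  assumes g: "lie_hom g" "lie_hom g'" and inv: "\<And>x. g (g' x) = x" "\<And>x. g' (g x) = x"
  shows "\<exists>!\<phi>. U_automorphism \<phi> \<and> (\<forall>x. \<phi> (\<iota> x) = \<iota> (g x))"
proof -
  obtain \<phi> where \<phi>: "U_hom \<phi>" "\<And>x. \<phi> (\<iota> x) = \<iota> (g x)"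
    using lie_hom_extends[OF g(1)] by blast
  obtain \<psi> where \<psi>: "U_hom \<psi>" "\<And>x. \<psi> (\<iota> x) = \<iota> (g' x)"
    using lie_hom_extends[OF g(2)] by blast
  have "\<phi> \<circ> \<psi> = id" "\<psi> \<circ> \<phi> = id"
    by (rule U_hom_unique; use \<phi> \<psi> inv in \<open>simp add: U_hom_def\<close>)+
  then have "bij \<phi>" using o_bij by blast
  show ?thesis
  proof (rule ex1I[of _ \<phi>])
    show "U_automorphism \<phi> \<and> (\<forall>x. \<phi> (\<iota> x) = \<iota> (g x))"
      using \<phi> \<open>bij \<phi>\<close> by (simp add: U_automorphism_def)
    fix \<theta> assume "U_automorphism \<theta> \<and> (\<forall>x. \<theta> (\<iota> x) = \<iota> (g x))"
    then show "\<theta> = \<phi>"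
      using \<phi> by (intro U_hom_unique) (simp_all add: U_automorphism_def)
  qed
qed

text \<open>
  The automorphism of the enveloping algebra induced by a linear map of matrices that restricts
  to a Lie algebra automorphism of \<open>sl\<^sub>2(C)\<close>. Existence and uniqueness are \<open>lie_hom_extends_bij\<close>,
  instantiated in \<open>U_automorphism_tau\<close> and \<open>U_automorphism_phi\<close>.
\<close>

definition U_aut :: "(complex^2^2 \<Rightarrow> complex^2^2) \<Rightarrow> usl2 \<Rightarrow> usl2" where
  "U_aut f = (THE \<phi>. U_automorphism \<phi> \<and> (\<forall>x. \<phi> (\<iota> x) = \<iota> (sl2_of (f (mat_of x)))))"

lemma U_aut:
  assumes "\<exists>!\<phi>. U_automorphism \<phi> \<and> (\<forall>x. \<phi> (\<iota> x) = \<iota> (sl2_of (f (mat_of x))))"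
  shows "U_automorphism (U_aut f)" "U_aut f (\<iota> x) = \<iota> (sl2_of (f (mat_of x)))"
  using theI'[OF assms] by (auto simp: U_aut_def)

definition tau_mat :: "complex^2^2 \<Rightarrow> complex^2^2" where
  "tau_mat A = - transpose A"

definition phi_mat :: "complex^2 \<Rightarrow> complex^2^2 \<Rightarrow> complex^2^2" where
  "phi_mat a A = (\<chi> i j. a $ i / a $ j * A $ i $ j)"

lemma tau_mat_unit: "tau_mat (mat_unit i j) = - mat_unit j i"
  by (auto simp: tau_mat_def mat_unit_def transpose_def vec_eq_iff)

lemma phi_mat_unit: "phi_mat a (mat_unit i j) = (\<chi> k l. a $ i / a $ j * mat_unit i j $ k $ l)"
  by (auto simp: phi_mat_def mat_unit_def vec_eq_iff)

definition \<tau> :: "usl2 \<Rightarrow> usl2" where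
  "\<tau> = U_aut tau_mat"

definition \<phi> :: "complex^2 \<Rightarrow> usl2 \<Rightarrow> usl2" where
  "\<phi> a = U_aut (phi_mat a)"

lemma mat_of_tau: "mat_of (sl2_of (tau_mat (mat_of x))) = tau_mat (mat_of x)"
  using mat_of[of x] by (simp add: sl2_of_inverse tau_mat_def trace_def transpose_def sum_negf)

lemma mat_of_phi:
  assumes "\<And>i. a $ i \<noteq> 0"
  shows "mat_of (sl2_of (phi_mat a (mat_of x))) = phi_mat a (mat_of x)"
  using mat_of[of x] assms by (simp add: sl2_of_inverse phi_mat_def trace_def)

lemma tau_mat_simps:
  "tau_mat (A + B) = tau_mat A + tau_mat B"
  "tau_mat (\<chi> i j. c * A $ i $ j) = (\<chi> i j. c * tau_mat A $ i $ j)"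
  "tau_mat (A ** B - B ** A) = tau_mat A ** tau_mat B - tau_mat B ** tau_mat A"
  by (simp_all add: tau_mat_def transpose_def vec_eq_iff matrix_matrix_mult_def mult.commute)

lemma phi_mat_simps:
  assumes a: "\<And>i. a $ i \<noteq> 0"
  shows "phi_mat a (A + B) = phi_mat a A + phi_mat a B"
    "phi_mat a (\<chi> i j. c * A $ i $ j) = (\<chi> i j. c * phi_mat a A $ i $ j)"
    "phi_mat a (A ** B - B ** A) = phi_mat a A ** phi_mat a B - phi_mat a B ** phi_mat a A"
proof -
  have mult: "phi_mat a (A ** B) = phi_mat a A ** phi_mat a B" for A B
    unfolding phi_mat_def matrix_matrix_mult_def vec_eq_iff
    by (auto simp: sum_distrib_left a intro!: sum.cong)
  have "phi_mat a (A - B) = phi_mat a A - phi_mat a B" for A B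
    by (simp add: phi_mat_def vec_eq_iff right_diff_distrib)
  with mult show "phi_mat a (A ** B - B ** A) = phi_mat a A ** phi_mat a B - phi_mat a B ** phi_mat a A"
    by simp
qed (simp_all add: phi_mat_def vec_eq_iff distrib_left)

lemma lie_hom_tau: "lie_hom (\<lambda>x. sl2_of (tau_mat (mat_of x)))"
  unfolding lie_hom_def
  by (simp only: mat_of_inject[symmetric] mat_of_tau,
      simp only: plus_sl2.rep_eq sl2_scale.rep_eq sl2_bracket.rep_eq mat_of_tau tau_mat_simps) simp

lemma lie_hom_phi:
  assumes a: "\<And>i. a $ i \<noteq> 0"
  shows "lie_hom (\<lambda>x. sl2_of (phi_mat a (mat_of x)))"
  unfolding lie_hom_def
  by (simp only: mat_of_inject[symmetric] mat_of_phi[OF a],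
      simp only: plus_sl2.rep_eq sl2_scale.rep_eq sl2_bracket.rep_eq mat_of_phi[OF a]
        phi_mat_simps[OF a]) simp

lemma U_automorphism_tau: "U_automorphism \<tau>" "\<tau> (\<iota> x) = \<iota> (sl2_of (tau_mat (mat_of x)))"
proof -
  have *: "sl2_of (tau_mat (mat_of (sl2_of (tau_mat (mat_of x))))) = x" for x
  proof -
    have "tau_mat (tau_mat A) = A" for A
      by (simp add: tau_mat_def transpose_def vec_eq_iff)
    then show ?thesis by (simp only: mat_of_tau mat_of_inverse)
  qed
  show "U_automorphism \<tau>" "\<tau> (\<iota> x) = \<iota> (sl2_of (tau_mat (mat_of x)))"
    unfolding \<tau>_def using U_aut[OF lie_hom_extends_bij[OF lie_hom_tau lie_hom_tau * *]] by blast+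
qed

lemma U_automorphism_phi:
  assumes a: "\<And>i. a $ i \<noteq> 0"
  shows "U_automorphism (\<phi> a)" "\<phi> a (\<iota> x) = \<iota> (sl2_of (phi_mat a (mat_of x)))"
proof -
  let ?a' = "\<chi> i. inverse (a $ i)"
  have a': "?a' $ i \<noteq> 0" for i using a by simp
  have "phi_mat a (phi_mat ?a' A) = A" "phi_mat ?a' (phi_mat a A) = A" for A
    using a by (simp_all add: phi_mat_def vec_eq_iff field_simps)
  then have *: "sl2_of (phi_mat a (mat_of (sl2_of (phi_mat ?a' (mat_of x))))) = x"
    "sl2_of (phi_mat ?a' (mat_of (sl2_of (phi_mat a (mat_of x))))) = x" for x
    by (simp_all only: mat_of_phi[OF a] mat_of_phi[OF a'] mat_of_inverse)
  show "U_automorphism (\<phi> a)" "\<phi> a (\<iota> x) = \<iota> (sl2_of (phi_mat a (mat_of x)))"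
    unfolding \<phi>_def
    using U_aut[OF lie_hom_extends_bij[OF lie_hom_phi[OF a] lie_hom_phi[OF a'] *]] by blast+
qed

definition \<sigma> :: "complex poly \<Rightarrow> complex poly" where
  "\<sigma> f = pcompose f [:-1, 1:]"

lemma \<sigma>_pcompose: "\<sigma> (pcompose f [:1, 1:]) = f" "pcompose (\<sigma> f) [:1, 1:] = f"
  by (simp_all add: \<sigma>_def pcompose_pCons flip: pcompose_assoc)

lemma inv_\<sigma>: "inv \<sigma> f = pcompose f [:1, 1:]"
  by (subst inv_equality[where g = "\<lambda>f. pcompose f [:1, 1:]"]) (simp_all add: \<sigma>_pcompose)

lemma bij_\<sigma>: "bij \<sigma>"
  by (rule bij_betw_byWitness[where f' = "\<lambda>f. pcompose f [:1, 1:]"]) (simp_all add: \<sigma>_pcompose)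

text \<open>
  The indeterminate of the polynomial ring is \<open>h\<close>, and a matrix \<open>A\<close> of trace zero equals
  \<open>2 A\<^sub>1\<^sub>1 h + A\<^sub>1\<^sub>2 e\<^sub>1\<^sub>2 + A\<^sub>2\<^sub>1 e\<^sub>2\<^sub>1\<close>.
\<close>

definition M' :: "complex \<Rightarrow> sl2 \<Rightarrow> complex poly \<Rightarrow> complex poly" where
  "M' b x f =
     smult (2 * mat_of x $ 1 $ 1) ([:0, 1:] * f)
   + smult (mat_of x $ 1 $ 2) (\<sigma> f)
   + smult (mat_of x $ 2 $ 1) (- ([:b + 1, 1:] * [:- b, 1:] * inv \<sigma> f))"

lemma M'_basis:
  "M' b sl2_h f = [:0, 1:] * f"
  "M' b (sl2_of (mat_unit 1 2)) f = \<sigma> f"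
  "M' b (sl2_of (mat_unit 2 1)) f = - ([:b + 1, 1:] * [:- b, 1:] * inv \<sigma> f)"
  by (simp_all add: M'_def sl2_h_def sl2_scale.rep_eq sl2_of_inverse trace_def sum_2 mat_unit_def)

end

theory Submission
  imports Defs
begin

text \<open>
  A submodule of \<open>M' b\<close> is an ideal of \<open>\<complex>[h]\<close> that is stable under \<open>\<sigma>\<close>. Since \<open>\<sigma> f - f\<close> has smaller
  degree than a nonconstant \<open>f\<close> and vanishes only for constant \<open>f\<close>, a nonzero element of least
  degree in a nonzero submodule is constant, so the submodule contains \<open>1\<close>. The twists by \<open>\<phi> a\<close>
  and \<open>\<tau>\<close> come from automorphisms of \<open>sl\<^sub>2\<close>, and precomposing with these does not change which
  subspaces are submodules.
\<close>

lemma sl2_module_twist: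
  assumes "sl2_module smul act" "lie_hom g"
  shows "sl2_module smul (\<lambda>x. act (g x))"
proof -
  interpret sl2_module smul act by fact
  show ?thesis
    using assms(2)
    by unfold_locales (simp_all add: lie_hom_def act_add_left act_scale_left act_bracket act_simps)
qed

text \<open>Since \<open>g\<close> is onto, the operators \<open>act (g x)\<close> are the same
  family as the operators \<open>act x\<close>, so they stabilize the same subspaces.\<close>

lemma simple_sl2_module_twist:
  assumes simple: "simple_sl2_module smul act" and g: "lie_hom g" "surj g"
  shows "simple_sl2_module smul (\<lambda>x. act (g x))"
proof -
  have M: "sl2_module smul act"
    using simple by (simp add: simple_sl2_module_def)
  note M' = sl2_module_twist[OF M g(1)]
  have "sl2_module.submodule smul (\<lambda>x. act (g x)) W \<longleftrightarrow> sl2_module.submodule smul act W" for W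
    unfolding sl2_module.submodule_def[OF M] sl2_module.submodule_def[OF M']
    using g(2) by (metis surjD)
  with simple M' show ?thesis
    by (simp add: simple_sl2_module_def)
qed

text \<open>\<open>F\<close> uses \<psi> only on the generators \<open>\<iota> x\<close>, where the
  action of the enveloping algebra is \<open>act\<close> itself; hence
  \<open>F smul \<psi> act\<close> is the twist by \<open>g\<close>.\<close>

lemma simple_sl2_module_F:
  assumes simple: "simple_sl2_module smul act" and g: "lie_hom g" "surj g"
    and \<psi>: "\<And>x. \<psi> (\<iota> x) = \<iota> (g x)"
  shows "simple_sl2_module smul (F smul \<psi> act)"
proof -
  have "sl2_module smul act"
    using simple by (simp add: simple_sl2_module_def)
  then have "F smul \<psi> act = (\<lambda>x. act (g x))"
    by (intro ext) (simp add: F_def \<psi> sl2_module.U_act_\<iota>)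
  with simple_sl2_module_twist[OF simple g] show ?thesis by simp
qed

text \<open>The first two assumptions say that \<open>f\<close> and \<open>f'\<close> preserve trace
  zero, so a right inverse on matrices descends to \<open>sl2\<close>.\<close>

lemma surj_sl2_map:
  assumes "\<And>x. mat_of (sl2_of (f (mat_of x))) = f (mat_of x)"
    and "\<And>x. mat_of (sl2_of (f' (mat_of x))) = f' (mat_of x)"
    and "\<And>A. f (f' A) = A"
  shows "surj (\<lambda>x. sl2_of (f (mat_of x)))"
  by (rule surjI[of _ "\<lambda>x. sl2_of (f' (mat_of x))"]) (simp add: assms mat_of_inverse)

lemma surj_tau: "surj (\<lambda>x. sl2_of (tau_mat (mat_of x)))"
  by (rule surj_sl2_map[of _ tau_mat])
    (simp_all only: mat_of_tau, simp add: tau_mat_def transpose_def vec_eq_iff)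

lemma surj_phi:
  assumes a: "\<And>i. a $ i \<noteq> 0"
  shows "surj (\<lambda>x. sl2_of (phi_mat a (mat_of x)))"
proof (rule surj_sl2_map)
  let ?a' = "\<chi> i. inverse (a $ i)"
  show "mat_of (sl2_of (phi_mat a (mat_of x))) = phi_mat a (mat_of x)" for x
    using a by (rule mat_of_phi)
  show "mat_of (sl2_of (phi_mat ?a' (mat_of x))) = phi_mat ?a' (mat_of x)" for x
    using a by (simp add: mat_of_phi)
  show "phi_mat a (phi_mat ?a' A) = A" for A
    using a by (simp add: phi_mat_def vec_eq_iff field_simps)
qed

text \<open>Pointwise, \<sigma> and its inverse become argument shifts, which reduces the module
  axioms to ring identities in the complex numbers.\<close>

lemma poly_M':
  "poly (M' b x f) z = 2 * mat_of x $ 1 $ 1 * (z * poly f z) + mat_of x $ 1 $ 2 * poly f (z - 1)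
     - mat_of x $ 2 $ 1 * ((z + b + 1) * (z - b) * poly f (z + 1))"
  by (simp add: M'_def \<sigma>_def inv_\<sigma> poly_pcompose algebra_simps)

lemma mat_of_22: "mat_of x $ 2 $ 2 = - mat_of x $ 1 $ 1"
  using mat_of[of x] by (simp add: trace_def sum_2 eq_neg_iff_add_eq_0 add.commute)

lemma sl2_module_M': "sl2_module smult (M' b)"
proof -
  interpret vector_space "smult :: complex \<Rightarrow> complex poly \<Rightarrow> complex poly"
    by unfold_locales (simp_all add: smult_add_left smult_add_right)
  show ?thesis
  proof unfold_locales
    fix x y :: sl2 and f g :: "complex poly" and c :: complex
    show "M' b x (f + g) = M' b x f + M' b x g"
      by (rule poly_ext) (simp add: poly_M' algebra_simps)
    show "M' b x (smult c f) = smult c (M' b x f)"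
      by (rule poly_ext) (simp add: poly_M' algebra_simps)
    show "M' b (x + y) f = M' b x f + M' b y f"
      by (rule poly_ext) (simp add: poly_M' plus_sl2.rep_eq algebra_simps)
    show "M' b (sl2_scale c x) f = smult c (M' b x f)"
      by (rule poly_ext) (simp add: poly_M' sl2_scale.rep_eq algebra_simps)
    \<comment> \<open>The key cancellation is
      \<open>(z + b + 1) * (z - b) - (z + b) * (z - 1 - b) = 2 * z\<close>, the relation that the
      bracket of \<open>e12\<close> and \<open>e21\<close> is \<open>2 h\<close>.\<close>
    show "M' b (sl2_bracket x y) f = M' b x (M' b y f) - M' b y (M' b x f)"
      by (rule poly_ext)
        (simp add: poly_M' sl2_bracket.rep_eq matrix_matrix_mult_def sum_2 mat_of_22 algebra_simps)
  qed
qed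

text \<open>The shift preserves degree and leading coefficient, so the top terms cancel.\<close>

lemma degree_\<sigma>_diff_less:
  assumes "degree f \<noteq> 0"
  shows "degree (\<sigma> f - f) < degree f"
proof -
  have deg: "degree (\<sigma> f) = degree f"
    by (simp add: \<sigma>_def degree_pcompose)
  have "lead_coeff (\<sigma> f) = lead_coeff f"
    unfolding \<sigma>_def by (subst lead_coeff_comp) auto
  then have "coeff (\<sigma> f - f) (degree f) = 0"
    by (simp add: deg)
  moreover have "degree (\<sigma> f - f) \<le> degree f"
    by (rule degree_diff_le) (simp_all add: deg)
  ultimately show ?thesis
    \<comment> \<open>If the difference is 0, its degree 0 is still smaller because \<open>f\<close>
      is nonconstant.\<close>
    using eq_zero_or_degree_less[of "\<sigma> f - f" "degree f"] assms by auto
qed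

text \<open>A fixed \<open>f\<close> has period 1, so \<open>f - f(0)\<close> vanishes at
  \<open>0, -1, -2, ...\<close> and has infinitely many roots.\<close>

lemma \<sigma>_fixed_imp_constant:
  assumes "\<sigma> f = f"
  shows "degree f = 0"
proof (rule ccontr)
  assume "degree f \<noteq> 0"
  let ?g = "f - [:poly f 0:]"
  have "poly f (- of_nat n) = poly f 0" for n
  proof (induction n)
    case (Suc n)
    have "poly f (- of_nat n) = poly (\<sigma> f) (- of_nat n)"
      using assms by simp
    also have "\<dots> = poly f (- of_nat (Suc n))"
      by (simp add: \<sigma>_def poly_pcompose algebra_simps)
    finally show ?case using Suc by simp
  qed simp
  then have "range (\<lambda>n. - of_nat n :: complex) \<subseteq> {z. poly ?g z = 0}"
    by auto
  moreover have "infinite (range (\<lambda>n. - of_nat n :: complex))"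
    by (rule range_inj_infinite) (simp add: inj_def)
  ultimately have "?g = 0"
    using poly_roots_finite[of ?g] finite_subset by blast
  then have "degree f = degree [:poly f 0:]"
    by simp
  with \<open>degree f \<noteq> 0\<close> show False by simp
qed

lemma simple_M': "simple_sl2_module smult (M' b)"
  unfolding simple_sl2_module_def
proof (intro conjI allI impI)
  interpret sl2_module smult "M' b" by (rule sl2_module_M')
  show "sl2_module smult (M' b)" by (rule sl2_module_M')
  show "(UNIV :: complex poly set) \<noteq> {0}"
    using one_neq_zero by blast
  fix W assume "submodule W"
  then have W: "subspace W" and act: "\<And>x f. f \<in> W \<Longrightarrow> M' b x f \<in> W"
    by (auto simp: submodule_def)
  have mult_h: "[:0, 1:] * f \<in> W" and \<sigma>: "\<sigma> f \<in> W" if "f \<in> W" for f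
    using act[OF that] M'_basis by metis+
  have "W = UNIV" if "W \<noteq> {0}"
  proof -
    have "\<exists>f\<in>W. f \<noteq> 0"
      using that subspace_0[OF W] by blast
    then obtain f where f: "f \<in> W" "f \<noteq> 0"
      and min: "\<And>g. g \<in> W \<Longrightarrow> g \<noteq> 0 \<Longrightarrow> degree f \<le> degree g"
      using exists_least_iff[of "\<lambda>n. \<exists>f. f \<in> W \<and> f \<noteq> 0 \<and> degree f = n"]
      by (metis not_le)
    have "degree f = 0"
    proof (rule ccontr)
      assume "degree f \<noteq> 0"
      then have "degree (\<sigma> f - f) < degree f"
        by (rule degree_\<sigma>_diff_less)
      \<comment> \<open>The difference lies in \<open>W\<close> and has degree below the
        minimum.\<close>
      then have "\<sigma> f - f = 0"
        using min[of "\<sigma> f - f"] subspace_diff[OF W \<sigma>[OF f(1)] f(1)] by linarith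
      with \<open>degree f \<noteq> 0\<close> show False
        using \<sigma>_fixed_imp_constant by simp
    qed
    then obtain c where "f = [:c:]" "c \<noteq> 0"
      using f(2) by (metis degree_eq_zeroE pCons_0_0)
    then have one: "1 \<in> W"
      using subspace_scale[OF W f(1), of "inverse c"] by (simp add: one_pCons)
    have "p \<in> W" for p
    proof (induction p)
      case 0
      show ?case by (rule subspace_0[OF W])
    next
      case (pCons c p)
      \<comment> \<open>Horner's scheme: \<open>1\<close> and multiplication by \<open>h\<close>
        generate every polynomial.\<close>
      have "pCons c p = smult c 1 + [:0, 1:] * p" by simp
      then show ?case
        using subspace_add[OF W subspace_scale[OF W one] mult_h[OF pCons(2)]] by metis
    qed
    then show ?thesis by blast
  qed
  then show "W = {0} \<or> W = UNIV" by blast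
qed

theorem lemma12:
  fixes a b :: complex
  assumes "a \<noteq> 0"
  shows "simple_sl2_module smult (F smult (\<phi> (vector [a, 1])) (M' b))
       \<and> simple_sl2_module smult (F smult \<tau> (F smult (\<phi> (vector [a, 1])) (M' b)))"
proof -
  let ?a = "vector [a, 1] :: complex^2"
  have a: "?a $ i \<noteq> 0" for i
    using exhaust_2[of i] assms by auto
  have simple: "simple_sl2_module smult (F smult (\<phi> ?a) (M' b))"
    using simple_M' lie_hom_phi[OF a] surj_phi[OF a] U_automorphism_phi(2)[OF a]
    by (rule simple_sl2_module_F)
  moreover have "simple_sl2_module smult (F smult \<tau> (F smult (\<phi> ?a) (M' b)))"
    using simple lie_hom_tau surj_tau U_automorphism_tau(2)
    by (rule simple_sl2_module_F)
  ultimately show ?thesis by blast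
qed

end
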